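(* Let $F_2=\langle a,b,c\mid abc=1\rangle$ and let $\rho:F_2\to\mathrm{PU}(2,1)$ be a representation such that $A=\rho(a)$, $B=\rho(b)$ and $AB=\rho(c^{-1})$ are all parabolic, and let $p_A$, $p_B$ and $p_{AB}$ be their fixed points in $\partial\mathbf{H}^2_{\mathbb{C}}$. Let $p_{BA}$ be the fixed point of $BA$, and assume that $p_A,p_B,p_{AB},p_{BA}$ are pairwise distinct. Let $J_1\in\mathrm{PU}(2,1)$ be the regular elliptic isometry of order three cyclically permuting $p_B,p_A,p_{AB}$ (i.e. $p_B\mapsto p_A\mapsto p_{AB}\mapsto p_B$), and let $J_2\in\mathrm{PU}(2,1)$ be the regular elliptic isometry of order three cyclically permuting $p_A,p_B,p_{BA}$ (i.e. $p_A\mapsto p_B\mapsto p_{BA}\mapsto p_A$). Then the following are equivalent: (i) $A=J_1J_2$ and $B=J_2J_1$. (ii) $\lambda_A$ and $\lambda_B$ are equal to the same cube root of the cross-ratio $\mathbb{X}(p_A,p_B,p_{AB},p_{BA})$ (for suitable choices of lifts of $A$ and $B$ to $\mathrm{SU}(2,1)$).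
   Context: $\langle\cdot,\cdot\rangle$ is a Hermitian form of signature $(2,1)$ on $\mathbb{C}^3$, linear in the first variable. $\mathbf{H}^2_{\mathbb{C}}$ (resp. $\partial\mathbf{H}^2_{\mathbb{C}}$) is the set of complex lines spanned by negative (resp. non-zero null) vectors; a lift of a point $p$ is a non-zero vector $\mathbf{p}\in\mathbb{C}^3$ spanning it. $\mathrm{PU}(2,1)$ is the holomorphic isometry group of $\mathbf{H}^2_{\mathbb{C}}$; $\mathrm{SU}(2,1)$ is a three-fold cover of it, and lifts of an isometry to $\mathrm{SU}(2,1)$ differ by multiplication by cube roots of unity. A parabolic isometry is one with exactly one fixed point in $\mathbf{H}^2_{\mathbb{C}}\cup\partial\mathbf{H}^2_{\mathbb{C}}$, lying on $\partial\mathbf{H}^2_{\mathbb{C}}$. An elliptic isometry (one with a fixed point in $\mathbf{H}^2_{\mathbb{C}}$) is regular if its lifts to $\mathrm{SU}(2,1)$ have three pairwise distinct eigenvalues. If $A$ fixes $p_A$, then $\lambda_A$ denotes the eigenvalue associated with $p_A$, defined by $\mathbf{A}\mathbf{p}_A=\lambda_A\mathbf{p}_A$ for a lift $\mathbf{A}\in\mathrm{SU}(2,1)$ of $A$; similarly $\lambda_B$ is the eigenvalue of $B$ associated with $p_B$. The cross-ratio is $$\mathbb{X}(p_1,p_2,p_3,p_4)=\frac{\langle\mathbf{p}_3,\mathbf{p}_1\rangle\langle\mathbf{p}_4,\mathbf{p}_2\rangle}{\langle\mathbf{p}_3,\mathbf{p}_2\rangle\langle\mathbf{p}_4,\mathbf{p}_1\rangle},$$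 which does not depend on the lifts. *)

theory Defs
  imports "HOL-Analysis.Analysis" "HOL-Algebra.Multiplicative_Group"
begin

section \<open>Groups given by generators and relators\<close>

text \<open>A letter \<open>(x, True)\<close> stands for the generator \<open>x\<close> and \<open>(x, False)\<close> for its formal inverse.\<close>

type_synonym 'g word = "('g \<times> bool) list"

inductive word_equiv :: "'g word set \<Rightarrow> 'g word \<Rightarrow> 'g word \<Rightarrow> bool" for R where
  refl: "word_equiv R u u"
| sym: "word_equiv R u v \<Longrightarrow> word_equiv R v u"
| trans: "word_equiv R u v \<Longrightarrow> word_equiv R v w \<Longrightarrow> word_equiv R u w"
| cancel: "word_equiv R (u @ [(x, s), (x, \<not> s)] @ v) (u @ v)"
| relator: "r \<in> R \<Longrightarrow> word_equiv R (u @ r @ v) (u @ v)"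

definition word_rel :: "'g word set \<Rightarrow> ('g word \<times> 'g word) set" where
  "word_rel R = {(u, v). word_equiv R u v}"

definition presented_group :: "'g word set \<Rightarrow> 'g word set monoid" where
  "presented_group R =
     \<lparr>carrier = UNIV // word_rel R,
      mult = (\<lambda>X Y. \<Union>u\<in>X. \<Union>v\<in>Y. word_rel R `` {u @ v}),
      one = word_rel R `` {[]}\<rparr>"

datatype F2_gen = GenA | GenB | GenC

definition F2_relators :: "F2_gen word set" where
  "F2_relators = {[(GenA, True), (GenB, True), (GenC, True)]}"

definition F2 :: "F2_gen word set monoid" where
  "F2 = presented_group F2_relators"

definition F2_class :: "F2_gen \<Rightarrow> F2_gen word set" where
  "F2_class x = word_rel F2_relators `` {[(x, True)]}"


section \<open>Hermitian forms of signature (2,1) and their unitary groups\<close>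

type_synonym form = "complex^3 \<Rightarrow> complex^3 \<Rightarrow> complex"

text \<open>The last conjunct says that the Gram matrix of some triple of vectors is
  \<open>diag(1, 1, -1)\<close>; such a triple is automatically a basis.\<close>

definition hermitian_form_21 :: "form \<Rightarrow> bool" where
  "hermitian_form_21 h \<longleftrightarrow>
     (\<forall>w. Vector_Spaces.linear (*s) (*) (\<lambda>v. h v w)) \<and>
     (\<forall>v w. h w v = cnj (h v w)) \<and>
     (\<exists>e1 e2 e3. h e1 e1 = 1 \<and> h e2 e2 = 1 \<and> h e3 e3 = -1 \<and>
                 h e1 e2 = 0 \<and> h e1 e3 = 0 \<and> h e2 e3 = 0)"

definition U21 :: "form \<Rightarrow> (complex^3^3) monoid" where
  "U21 h = \<lparr>carrier = {M. \<forall>v w. h (M *v v) (M *v w) = h v w}, mult = (**), one = mat 1\<rparr>"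

definition unit_scalars :: "(complex^3^3) set" where
  "unit_scalars = {mat z |z. cmod z = 1}"

text \<open>An element of \<open>PU(2,1)\<close> is a coset of the group of unitary scalar matrices in \<open>U(2,1)\<close>,
  i.e. the set of all its lifts to \<open>U(2,1)\<close>.\<close>

definition PU21 :: "form \<Rightarrow> (complex^3^3) set monoid" where
  "PU21 h = U21 h Mod unit_scalars"

definition SU_lifts :: "(complex^3^3) set \<Rightarrow> (complex^3^3) set" where
  "SU_lifts g = {M \<in> g. det M = 1}"


section \<open>The complex hyperbolic plane\<close>

text \<open>A point is a complex line in \<open>\<complex>\<^sup>3\<close>, as a set of vectors (including 0).
  For a Hermitian form \<open>h v v\<close> is real, so \<open>Re\<close> loses nothing.\<close>

definition complex_hyperbolic_plane :: "form \<Rightarrow> (complex^3) set set" where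
  "complex_hyperbolic_plane h = {vec.span {v} |v. Re (h v v) < 0}"

definition ideal_boundary :: "form \<Rightarrow> (complex^3) set set" where
  "ideal_boundary h = {vec.span {v} |v. v \<noteq> 0 \<and> h v v = 0}"

definition point_lift :: "complex^3 \<Rightarrow> (complex^3) set \<Rightarrow> bool" where
  "point_lift v p \<longleftrightarrow> v \<noteq> 0 \<and> vec.span {v} = p"

text \<open>The matrices in a coset differ by scalars, so all of them map the line \<open>p\<close> to the same line,
  see \<open>act_line\<close> below.\<close>

definition act :: "(complex^3^3) set \<Rightarrow> (complex^3) set \<Rightarrow> (complex^3) set" where
  "act g p = {M *v v |M v. M \<in> g \<and> v \<in> p}"

definition fixed_points :: "form \<Rightarrow> (complex^3^3) set \<Rightarrow> (complex^3) set set" where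
  "fixed_points h g = {p \<in> complex_hyperbolic_plane h \<union> ideal_boundary h. act g p = p}"

definition parabolic :: "form \<Rightarrow> (complex^3^3) set \<Rightarrow> bool" where
  "parabolic h g \<longleftrightarrow> g \<in> carrier (PU21 h) \<and> (\<exists>p \<in> ideal_boundary h. fixed_points h g = {p})"

definition elliptic :: "form \<Rightarrow> (complex^3^3) set \<Rightarrow> bool" where
  "elliptic h g \<longleftrightarrow> g \<in> carrier (PU21 h) \<and> (\<exists>p \<in> complex_hyperbolic_plane h. act g p = p)"

definition eigenvalues :: "complex^3^3 \<Rightarrow> complex set" where
  "eigenvalues M = {z. \<exists>v. v \<noteq> 0 \<and> M *v v = z *s v}"

definition regular_elliptic :: "form \<Rightarrow> (complex^3^3) set \<Rightarrow> bool" where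
  "regular_elliptic h g \<longleftrightarrow> elliptic h g \<and> (\<forall>M \<in> SU_lifts g. card (eigenvalues M) = 3)"

text \<open>Meaningful only if \<open>M\<close> maps the line \<open>p\<close> to itself.\<close>

definition eigenvalue_at :: "complex^3^3 \<Rightarrow> (complex^3) set \<Rightarrow> complex" where
  "eigenvalue_at M p = (THE z. \<forall>v. point_lift v p \<longrightarrow> M *v v = z *s v)"

definition cross_ratio_vec ::
    "form \<Rightarrow> complex^3 \<Rightarrow> complex^3 \<Rightarrow> complex^3 \<Rightarrow> complex^3 \<Rightarrow> complex" where
  "cross_ratio_vec h v1 v2 v3 v4 = (h v3 v1 * h v4 v2) / (h v3 v2 * h v4 v1)"

text \<open>The choice of lifts is immaterial, see \<open>cross_ratio_eq\<close> below.\<close>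

definition cross_ratio ::
    "form \<Rightarrow> (complex^3) set \<Rightarrow> (complex^3) set \<Rightarrow> (complex^3) set \<Rightarrow> (complex^3) set \<Rightarrow> complex" where
  "cross_ratio h p1 p2 p3 p4 =
     cross_ratio_vec h (SOME v. point_lift v p1) (SOME v. point_lift v p2)
                       (SOME v. point_lift v p3) (SOME v. point_lift v p4)"


section \<open>Well-definedness\<close>

lemma equiv_word_rel: "equiv UNIV (word_rel R)"
  by (rule equivI)
     (auto simp: word_rel_def refl_on_def sym_def trans_def
       intro: word_equiv.refl word_equiv.sym word_equiv.trans)

lemma word_equiv_prefix: "word_equiv R u v \<Longrightarrow> word_equiv R (w @ u) (w @ v)"
proof (induction rule: word_equiv.induct)
  case (cancel u x s v) then show ?case
    using word_equiv.cancel[of R "w @ u" x s v] by simp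
next
  case (relator r u v) then show ?case
    using word_equiv.relator[of r R "w @ u" v] by simp
qed (auto intro: word_equiv.refl word_equiv.sym word_equiv.trans)

lemma word_equiv_suffix: "word_equiv R u v \<Longrightarrow> word_equiv R (u @ w) (v @ w)"
proof (induction rule: word_equiv.induct)
  case (cancel u x s v) then show ?case
    using word_equiv.cancel[of R u x s "v @ w"] by simp
next
  case (relator r u v) then show ?case
    using word_equiv.relator[of r R u "v @ w"] by simp
qed (auto intro: word_equiv.refl word_equiv.sym word_equiv.trans)

lemma word_class_eq_iff: "word_rel R `` {u} = word_rel R `` {v} \<longleftrightarrow> word_equiv R u v"
  using eq_equiv_class_iff[OF equiv_word_rel, of u v R] by (simp add: word_rel_def)

lemma presented_group_mult:
  "word_rel R `` {u} \<otimes>\<^bsub>presented_group R\<^esub> word_rel R `` {v} = word_rel R `` {u @ v}"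
proof -
  have "word_rel R `` {u' @ v'} = word_rel R `` {u @ v}"
    if "word_equiv R u u'" "word_equiv R v v'" for u' v'
    unfolding word_class_eq_iff
    using that word_equiv_prefix word_equiv_suffix word_equiv.sym word_equiv.trans by metis
  moreover have "u \<in> word_rel R `` {u}" "v \<in> word_rel R `` {v}"
    by (auto simp: word_rel_def intro: word_equiv.refl)
  ultimately have "word_rel R `` {u} \<noteq> {}" "word_rel R `` {v} \<noteq> {}"
    "\<And>u' v'. u' \<in> word_rel R `` {u} \<Longrightarrow> v' \<in> word_rel R `` {v} \<Longrightarrow>
       word_rel R `` {u' @ v'} = word_rel R `` {u @ v}"
    by (blast, blast, unfold word_rel_def Image_singleton_iff mem_Collect_eq prod.case) blast
  then have "(\<Union>u'\<in>word_rel R `` {u}. \<Union>v'\<in>word_rel R `` {v}. word_rel R `` {u' @ v'})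
      = (\<Union>u'\<in>word_rel R `` {u}. \<Union>v'\<in>word_rel R `` {v}. word_rel R `` {u @ v})"
    by (intro SUP_cong refl) blast+
  with \<open>word_rel R `` {u} \<noteq> {}\<close> \<open>word_rel R `` {v} \<noteq> {}\<close> show ?thesis
    by (simp only: presented_group_def monoid.simps SUP_constant if_False)
qed

definition inv_word :: "'g word \<Rightarrow> 'g word" where
  "inv_word u = rev (map (\<lambda>(x, s). (x, \<not> s)) u)"

lemma inv_word_left: "word_equiv R (inv_word u @ u) []"
proof (induction u)
  case (Cons a u)
  obtain x s where a: "a = (x, s)" by (cases a)
  have "word_equiv R (inv_word u @ [(x, \<not> s), (x, \<not> \<not> s)] @ u) (inv_word u @ u)"
    by (rule word_equiv.cancel)
  with Cons show ?case
    by (auto simp: inv_word_def a intro: word_equiv.trans)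
qed (simp add: inv_word_def word_equiv.refl)

lemma group_presented_group: "group (presented_group R)"
proof (rule groupI)
  note carrier_cases = quotientE[where A = UNIV and r = "word_rel R"]
  have [simp]: "carrier (presented_group R) = UNIV // word_rel R"
    "\<one>\<^bsub>presented_group R\<^esub> = word_rel R `` {[]}"
    by (simp_all add: presented_group_def)
  fix X assume X: "X \<in> carrier (presented_group R)"
  then obtain u where u: "X = word_rel R `` {u}" by (auto elim: carrier_cases)
  show "\<one>\<^bsub>presented_group R\<^esub> \<otimes>\<^bsub>presented_group R\<^esub> X = X"
    by (simp add: u presented_group_mult)
  show "\<exists>Y \<in> carrier (presented_group R). Y \<otimes>\<^bsub>presented_group R\<^esub> X = \<one>\<^bsub>presented_group R\<^esub>"
    by (rule bexI[of _ "word_rel R `` {inv_word u}"])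
       (simp_all add: u presented_group_mult word_class_eq_iff inv_word_left quotientI)
  fix Y assume "Y \<in> carrier (presented_group R)"
  then obtain v where v: "Y = word_rel R `` {v}" by (auto elim: carrier_cases)
  show "X \<otimes>\<^bsub>presented_group R\<^esub> Y \<in> carrier (presented_group R)"
    by (simp add: u v presented_group_mult quotientI)
  fix Z assume "Z \<in> carrier (presented_group R)"
  then obtain w where w: "Z = word_rel R `` {w}" by (auto elim: carrier_cases)
  show "X \<otimes>\<^bsub>presented_group R\<^esub> Y \<otimes>\<^bsub>presented_group R\<^esub> Z
      = X \<otimes>\<^bsub>presented_group R\<^esub> (Y \<otimes>\<^bsub>presented_group R\<^esub> Z)"
    by (simp add: u v w presented_group_mult)
qed (simp add: presented_group_def quotientI)

lemma group_F2: "group F2"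
  unfolding F2_def by (rule group_presented_group)

lemma F2_class_carrier: "F2_class x \<in> carrier F2"
  by (simp add: F2_class_def F2_def presented_group_def quotientI)

lemma F2_relation: "F2_class GenA \<otimes>\<^bsub>F2\<^esub> F2_class GenB \<otimes>\<^bsub>F2\<^esub> F2_class GenC = \<one>\<^bsub>F2\<^esub>"
proof -
  have "word_equiv F2_relators ([] @ [(GenA, True), (GenB, True), (GenC, True)] @ []) ([] @ [])"
    by (rule word_equiv.relator) (simp add: F2_relators_def)
  then have "word_rel F2_relators `` {[(GenA, True), (GenB, True), (GenC, True)]}
      = word_rel F2_relators `` {[]}"
    by (simp add: word_class_eq_iff)
  then show ?thesis
    unfolding F2_class_def F2_def by (simp add: presented_group_mult) (simp add: presented_group_def)
qed

lemma F2_inv_c: "inv\<^bsub>F2\<^esub> F2_class GenC = F2_class GenA \<otimes>\<^bsub>F2\<^esub> F2_class GenB"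
  by (intro group.inv_equality group_F2 F2_relation F2_class_carrier
        monoid.m_closed group.is_monoid)

lemma form_simps:
  assumes "hermitian_form_21 h"
  shows "h (v + v') w = h v w + h v' w" "h (c *s v) w = c * h v w"
    "h w (v + v') = h w v + h w v'" "h w (c *s v) = cnj c * h w v"
proof -
  have lin: "Vector_Spaces.linear (*s) (*) (\<lambda>v. h v w)" for w
    using assms unfolding hermitian_form_21_def by blast
  have cnj: "h w v = cnj (h v w)" for v w
    using assms unfolding hermitian_form_21_def by blast
  have 1: "h (v + v') w = h v w + h v' w" for v v' w
    using Vector_Spaces.linear.axioms(3)[OF lin[of w]] by (rule module_hom.add)
  have 2: "h (c *s v) w = c * h v w" for v w c
    using Vector_Spaces.linear.axioms(3)[OF lin[of w]] by (rule module_hom.scale)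
  show "h (v + v') w = h v w + h v' w" "h (c *s v) w = c * h v w"
    by (fact 1 2)+
  show "h w (v + v') = h w v + h w v'"
    by (metis cnj 1 complex_cnj_add)
  show "h w (c *s v) = cnj c * h w v"
    by (metis cnj 2 complex_cnj_mult)
qed

lemma form_nondegenerate:
  assumes "hermitian_form_21 h" and "\<And>w. h v w = 0"
  shows "v = 0"
proof -
  note simps = form_simps[OF assms(1)]
  obtain e1 e2 e3 where e: "h e1 e1 = 1" "h e2 e2 = 1" "h e3 e3 = -1"
      "h e1 e2 = 0" "h e1 e3 = 0" "h e2 e3 = 0"
    using assms(1) unfolding hermitian_form_21_def by blast
  have cnj: "h w v = cnj (h v w)" for v w
    using assms(1) unfolding hermitian_form_21_def by blast
  have e': "h e2 e1 = 0" "h e3 e1 = 0" "h e3 e2 = 0"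
    using e cnj[of e1 e2] cnj[of e1 e3] cnj[of e2 e3] by simp_all
  have zero: "h 0 w = 0" for w using simps(2)[of 0 0 w] by simp
  let ?E = "(\<chi> i j. (if j = 1 then e1 else if j = 2 then e2 else e3) $ i) :: complex^3^3"
  have E: "?E *v c = c$1 *s e1 + c$2 *s e2 + c$3 *s e3" for c
    by (simp add: vec_eq_iff matrix_vector_mult_def sum_3 forall_3 mult.commute)
  have "c = 0" if "?E *v c = 0" for c
  proof -
    have "h (c$1 *s e1 + c$2 *s e2 + c$3 *s e3) w = 0" for w
      using that unfolding E by (simp add: zero)
    from this[of e1] this[of e2] this[of e3] show ?thesis
      by (simp add: simps e e' vec_eq_iff forall_3)
  qed
  then have "invertible ?E"
    by (simp add: invertible_left_inverse matrix_left_invertible_ker)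
  then obtain E' where "?E ** E' = mat 1" unfolding invertible_def by blast
  then have "v = ?E *v (E' *v v)"
    by (simp only: matrix_vector_mul_assoc matrix_vector_mul_lid)
  from this[unfolded E] obtain c :: "complex^3" where v: "v = c$1 *s e1 + c$2 *s e2 + c$3 *s e3"
    by (rule that)
  from assms(2)[of e1] assms(2)[of e2] assms(2)[of e3] show ?thesis
    unfolding v by (simp add: simps e e')
qed

lemma group_U21:
  assumes "hermitian_form_21 h"
  shows "group (U21 h)"
proof (rule groupI)
  fix M assume "M \<in> carrier (U21 h)"
  then have M: "h (M *v v) (M *v w) = h v w" for v w by (simp add: U21_def)
  have "v = 0" if "M *v v = 0" for v
  proof (rule form_nondegenerate[OF assms])
    show "h v w = 0" for w
      using M[of v w] that form_simps(2)[OF assms, of 0 0 "M *v w"] by simp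
  qed
  then obtain N where N: "N ** M = mat 1"
    using matrix_left_invertible_ker[of M] by blast
  then have "M ** N = mat 1" by (simp add: matrix_left_right_inverse)
  then have "h (N *v v) (N *v w) = h v w" for v w
    using M[of "N *v v" "N *v w"] by (simp add: matrix_vector_mul_assoc)
  with N show "\<exists>N\<in>carrier (U21 h). N \<otimes>\<^bsub>U21 h\<^esub> M = \<one>\<^bsub>U21 h\<^esub>"
    by (auto simp: U21_def)
qed (auto simp: U21_def matrix_mul_assoc simp flip: matrix_vector_mul_assoc)

lemma mat_vector_mult: "mat z *v v = (z *s v :: 'a::comm_semiring_1 ^ 'n)"
  by (simp add: mat_def matrix_vector_mult_def vec_eq_iff if_distrib[of "\<lambda>x. x * y" for y]
      cong: if_cong)

lemma normal_unit_scalars: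
  assumes "hermitian_form_21 h"
  shows "unit_scalars \<lhd> U21 h"
proof -
  interpret group "U21 h" by (rule group_U21[OF assms])
  have mult: "mat a ** (mat b :: complex^3^3) = mat (a * b)" for a b
    by (simp add: matrix_eq mat_vector_mult flip: matrix_vector_mul_assoc)
  have comm: "M ** mat z = mat z ** M" for M :: "complex^3^3" and z
    by (simp add: matrix_eq mat_vector_mult vec.scale flip: matrix_vector_mul_assoc)
  have one: "\<one>\<^bsub>U21 h\<^esub> = mat 1" and times: "M \<otimes>\<^bsub>U21 h\<^esub> N = M ** N" for M N
    by (simp_all add: U21_def)
  have carr: "mat z \<in> carrier (U21 h)" if "cmod z = 1" for z
  proof -
    have "z * cnj z = 1"
      using that complex_norm_square[of z] by simp
    then show ?thesis
      by (simp add: U21_def mat_vector_mult form_simps[OF assms] mult.commute[of "cnj z"])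
  qed
  have inv: "inv\<^bsub>U21 h\<^esub> (mat z) = mat (inverse z)" if "cmod z = 1" for z
  proof -
    have "z \<noteq> 0" using that by auto
    with that carr show ?thesis
      by (intro inv_equality) (simp_all add: one times mult norm_inverse)
  qed
  have "subgroup unit_scalars (U21 h)"
  proof (rule subgroupI)
    show "unit_scalars \<subseteq> carrier (U21 h)" using carr by (auto simp: unit_scalars_def)
    show "unit_scalars \<noteq> {}" unfolding unit_scalars_def using norm_one by blast
    fix M assume "M \<in> unit_scalars"
    then obtain a where a: "M = mat a" "cmod a = 1" by (auto simp: unit_scalars_def)
    have "cmod (inverse a) = 1" using a by (simp add: norm_inverse)
    with a inv[of a] show "inv\<^bsub>U21 h\<^esub> M \<in> unit_scalars"
      unfolding unit_scalars_def by blast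
    fix N assume "N \<in> unit_scalars"
    then obtain b where b: "N = mat b" "cmod b = 1" by (auto simp: unit_scalars_def)
    have "cmod (a * b) = 1" using a b by (simp add: norm_mult)
    with a b show "M \<otimes>\<^bsub>U21 h\<^esub> N \<in> unit_scalars"
      unfolding unit_scalars_def by (auto simp: times mult)
  qed
  moreover have "M \<otimes>\<^bsub>U21 h\<^esub> N \<otimes>\<^bsub>U21 h\<^esub> inv\<^bsub>U21 h\<^esub> M \<in> unit_scalars"
    if M: "M \<in> carrier (U21 h)" and N: "N \<in> unit_scalars" for M N
  proof -
    from N obtain z where z: "N = mat z" "cmod z = 1" by (auto simp: unit_scalars_def)
    then have "M \<otimes>\<^bsub>U21 h\<^esub> N = N \<otimes>\<^bsub>U21 h\<^esub> M" by (simp add: times comm)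
    with M N z carr[of z] show ?thesis by (simp add: m_assoc)
  qed
  ultimately show ?thesis by (intro normal_invI) auto
qed

lemma group_PU21: "hermitian_form_21 h \<Longrightarrow> group (PU21 h)"
  unfolding PU21_def by (intro normal.factorgroup_is_group normal_unit_scalars)

lemma act_line:
  assumes "hermitian_form_21 h" and "g \<in> carrier (PU21 h)" and "M \<in> g"
  shows "act g (vec.span {v}) = vec.span {M *v v}"
proof -
  interpret normal unit_scalars "U21 h" by (rule normal_unit_scalars[OF assms(1)])
  from assms(2) obtain N where "N \<in> carrier (U21 h)" "g = unit_scalars #>\<^bsub>U21 h\<^esub> N"
    by (auto simp: PU21_def FactGroup_def RCOSETS_def)
  with assms(3) have "g = unit_scalars #>\<^bsub>U21 h\<^esub> M"
    using repr_independence[OF _ _ is_subgroup] by blast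
  then have g: "g = {mat z ** M |z. cmod z = 1}"
    by (auto simp: r_coset_def unit_scalars_def U21_def)
  have prod: "(mat z ** M) *v (c *s v) = (z * c) *s (M *v v)" for z c
    by (simp add: mat_vector_mult vec.scale flip: matrix_vector_mul_assoc)
  show ?thesis
  proof (rule Set.set_eqI, rule iffI)
    fix x assume "x \<in> act g (vec.span {v})"
    then show "x \<in> vec.span {M *v v}"
      by (auto simp: act_def g vec.span_singleton prod)
  next
    fix x assume "x \<in> vec.span {M *v v}"
    then obtain c where "x = (1 * c) *s (M *v v)"
      by (auto simp: vec.span_singleton)
    then have "x = (mat 1 ** M) *v (c *s v)" by (simp only: prod)
    moreover have "mat 1 ** M \<in> g" unfolding g using norm_one by blast
    moreover have "c *s v \<in> vec.span {v}" by (auto simp: vec.span_singleton)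
    ultimately show "x \<in> act g (vec.span {v})" unfolding act_def by blast
  qed
qed

lemma point_lift_unique:
  assumes "point_lift v p" "point_lift w p"
  obtains c where "c \<noteq> 0" "w = c *s v"
proof -
  have "w \<in> vec.span {v}" using assms vec.span_base[of w "{w}"] by (auto simp: point_lift_def)
  then obtain c where "w = c *s v" by (auto simp: vec.span_singleton)
  with assms that show ?thesis by (auto simp: point_lift_def)
qed

lemma cross_ratio_eq:
  assumes "hermitian_form_21 h"
    and "point_lift v1 p1" "point_lift v2 p2" "point_lift v3 p3" "point_lift v4 p4"
  shows "cross_ratio h p1 p2 p3 p4 = cross_ratio_vec h v1 v2 v3 v4"
proof -
  have "\<exists>c. c \<noteq> 0 \<and> (SOME v. point_lift v p) = c *s v" if "point_lift v p" for v p
    using point_lift_unique[OF that someI[of "\<lambda>v. point_lift v p", OF that]] by metis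
  from this[OF assms(2)] this[OF assms(3)] this[OF assms(4)] this[OF assms(5)]
  obtain c1 c2 c3 c4 where "c1 \<noteq> 0" "(SOME v. point_lift v p1) = c1 *s v1"
    "c2 \<noteq> 0" "(SOME v. point_lift v p2) = c2 *s v2"
    "c3 \<noteq> 0" "(SOME v. point_lift v p3) = c3 *s v3"
    "c4 \<noteq> 0" "(SOME v. point_lift v p4) = c4 *s v4"
    by blast
  then show ?thesis
    by (simp add: cross_ratio_def cross_ratio_vec_def form_simps[OF assms(1)])
qed

lemma eigenvalue_at_eq:
  assumes "point_lift v p" and "M *v v = z *s v"
  shows "eigenvalue_at M p = z"
  unfolding eigenvalue_at_def
proof (rule the_equality)
  show "\<forall>w. point_lift w p \<longrightarrow> M *v w = z *s w"
    using assms point_lift_unique[OF assms(1)] by (metis vec.scale vec.scale_left_commute)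
  fix y assume "\<forall>w. point_lift w p \<longrightarrow> M *v w = y *s w"
  with assms show "y = z" by (auto simp: point_lift_def)
qed

end

theory Submission
  imports Defs
begin

text \<open>Everything is computed with matrices of determinant 1. Let \<open>M\<close> and \<open>N\<close> be lifts of \<open>J1\<close> and
  \<open>J2\<close> to \<open>SU(2,1)\<close>. Regularity forces their cubes to be the identity and not just some scalar
  (\<open>regular_order_three_SU_lift_cube\<close>), so starting from one lift \<open>v2\<close> of \<open>pB\<close> the two rotations
  produce lifts of all four points:
  \<open>v1 = M v2\<close>, \<open>v3 = M v1\<close>, \<open>M v3 = v2\<close> and \<open>N v1 = s v2\<close>, \<open>v4 = N v2\<close>, \<open>N v4 = v1 / s\<close>.
  The only freedom left is the scalar \<open>s\<close>. Both \<open>M N v1 = s v1\<close> and \<open>N M v2 = s v2\<close> hold, and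
  invariance of the Hermitian form expresses the cross-ratio through \<open>s\<close> alone: it is
  \<open>s / (cnj s)\<^sup>2\<close> (\<open>cross_ratio_of_two_triangle_rotations\<close>), which is \<open>s ^ 3\<close> as soon as
  \<open>cmod s = 1\<close>.

  If \<open>A = J1 J2\<close> and \<open>B = J2 J1\<close>, then \<open>s\<close> is the common eigenvalue \<open>\<lambda>\<^sub>A = \<lambda>\<^sub>B\<close>, and it has
  modulus 1 because a parabolic isometry has no other boundary fixed point
  (\<open>parabolic_eigenvalue_unit\<close>).

  Conversely, let \<open>\<lambda>\<close> be the common eigenvalue, of modulus 1 as before. Comparing
  moduli in \<open>\<lambda> ^ 3 = s / (cnj s)\<^sup>2\<close> gives
  \<open>cmod s = 1\<close>, hence \<open>s ^ 3 = \<lambda> ^ 3\<close>, and replacing \<open>N\<close> by a multiple by a cube root of unity makes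
  \<open>s = \<lambda>\<close>. Since \<open>A\<close> conjugates \<open>BA\<close> to \<open>AB\<close>, it maps \<open>pBA\<close> to \<open>pAB\<close>, as \<open>J1 J2\<close> does. So the lifts
  of \<open>A\<close> and \<open>J1 J2\<close> agree on \<open>v1\<close>, and agree on \<open>v4\<close> up to a factor, which invariance of the
  form forces to be 1. Isometries that agree on the plane spanned by two distinct null lines can differ
  only on its orthogonal complement, a line, and there the determinant decides
  (\<open>unitary_determined_by_null_points\<close>). The same argument with \<open>v2\<close> and \<open>v3\<close> identifies
  \<open>B\<close> with \<open>J2 J1\<close>.\<close>

section \<open>Isotropic vectors\<close>

lemma form_cnj: "hermitian_form_21 h \<Longrightarrow> h w v = cnj (h v w)"
  unfolding hermitian_form_21_def by blast

lemma form_zero: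
  assumes "hermitian_form_21 h"
  shows "h 0 w = 0" "h w 0 = 0"
  using form_simps(2)[OF assms, of 0 0 w] form_simps(4)[OF assms, of w 0 0] by simp_all

lemma form_diff:
  assumes "hermitian_form_21 h"
  shows "h (v - v') w = h v w - h v' w" "h w (v - v') = h w v - h w v'"
  unfolding eq_diff_eq form_simps(1,3)[OF assms, symmetric] by simp_all

lemma linear_pairings:
  assumes h: "hermitian_form_21 h"
  shows "Vector_Spaces.linear (*s) (*s) (\<lambda>x. (\<chi> i. h x (e i)) :: complex^3)"
  by (simp add: Vector_Spaces.linear_iff vec.vector_space_axioms vec_eq_iff form_simps[OF h])

text \<open>The pairings with the three frame vectors are the coordinates up to sign, and they define a
  surjective endomorphism of a finite-dimensional space, which is therefore injective.\<close>

lemma frame_separates: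
  assumes h: "hermitian_form_21 h"
    and e: "h e1 e1 = 1" "h e2 e2 = 1" "h e3 e3 = -1" "h e1 e2 = 0" "h e1 e3 = 0" "h e2 e3 = 0"
    and d: "h d e1 = 0" "h d e2 = 0" "h d e3 = 0"
  shows "d = 0"
proof -
  have e': "h e2 e1 = 0" "h e3 e1 = 0" "h e3 e2 = 0"
    using e form_cnj[OF h, of e2 e1] form_cnj[OF h, of e3 e1] form_cnj[OF h, of e3 e2] by simp_all
  define f :: "complex^3 \<Rightarrow> complex^3" where
    "f x = (\<chi> i. h x (if i = 1 then e1 else if i = 2 then e2 else e3))" for x
  have lin: "Vector_Spaces.linear (*s) (*s) f"
    unfolding f_def by (rule linear_pairings[OF h])
  have "\<exists>x. y = f x" for y
    by (rule exI[of _ "y$1 *s e1 + y$2 *s e2 + (- y$3) *s e3"])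
       (simp add: f_def vec_eq_iff forall_3 form_simps[OF h] form_diff[OF h] e e')
  then have "inj f"
    using vec.linear_surjective_imp_injective[OF lin] by (auto simp: surj_def)
  moreover have "f d = f 0"
    by (simp add: f_def vec_eq_iff d form_zero[OF h])
  ultimately show ?thesis by (simp add: inj_eq)
qed

text \<open>Signature \<open>(2,1)\<close> leaves room for isotropic subspaces of dimension at most one: some
  non-trivial combination of \<open>v\<close> and \<open>w\<close> is orthogonal to the negative frame vector, and the form is
  positive definite on the orthogonal complement of that vector.\<close>

lemma isotropic_orthogonal_imp_parallel:
  assumes h: "hermitian_form_21 h"
    and null: "h v v = 0" "h w w = 0" "h v w = 0"
  obtains a b where "(a, b) \<noteq> (0, 0)" "a *s v = b *s w"
proof -
  obtain e1 e2 e3 where e: "h e1 e1 = 1" "h e2 e2 = 1" "h e3 e3 = -1"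
      "h e1 e2 = 0" "h e1 e3 = 0" "h e2 e3 = 0"
    using h unfolding hermitian_form_21_def by blast
  have e': "h e2 e1 = 0" "h e3 e1 = 0" "h e3 e2 = 0"
    using e form_cnj[OF h, of e2 e1] form_cnj[OF h, of e3 e1] form_cnj[OF h, of e3 e2] by simp_all
  note simps = form_simps[OF h] form_diff[OF h] e e'
  have definite: "u = 0" if u: "h u e3 = 0" "h u u = 0" for u
  proof -
    have "u - (h u e1 *s e1 + h u e2 *s e2) = 0"
      by (rule frame_separates[OF h e]) (simp_all add: simps u)
    then have dec: "u = h u e1 *s e1 + h u e2 *s e2" by simp
    define a b where "a = h u e1" and "b = h u e2"
    have uu: "u = a *s e1 + b *s e2" using dec by (simp add: a_def b_def)
    have "a * cnj a + b * cnj b = 0"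
      using u(2) unfolding uu by (simp add: simps mult.commute)
    then have "complex_of_real ((cmod a)\<^sup>2 + (cmod b)\<^sup>2) = 0"
      by (simp only: complex_norm_square of_real_add)
    then have "(cmod a)\<^sup>2 + (cmod b)\<^sup>2 = 0" using of_real_eq_0_iff by blast
    then have "a = 0" "b = 0" by (simp_all add: sum_power2_eq_zero_iff)
    then show ?thesis by (simp add: uu)
  qed
  have "h w v = 0" using null form_cnj[OF h, of w v] by simp
  \<comment> \<open>The combination is chosen to cancel the component along the negative vector \<open>e3\<close>.\<close>
  then have "h w e3 *s v - h v e3 *s w = 0"
    by (intro definite) (simp_all add: simps null)
  then have eq: "h w e3 *s v = h v e3 *s w" by simp
  show ?thesis
  proof (cases "(h w e3, h v e3) = (0, 0)")
    case True
    then have "v = 0" using definite[of v] null by simp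
    then show ?thesis using that[of 1 0] by simp
  next
    case False
    then show ?thesis using that eq by blast
  qed
qed

lemma point_lift_scale:
  assumes "point_lift v p" "c \<noteq> 0"
  shows "point_lift (c *s v) p"
proof -
  have "vec.span {c *s v} = vec.span {v}"
  proof
    show "vec.span {c *s v} \<subseteq> vec.span {v}"
      by (auto simp: vec.span_singleton)
    have "k *s v = (k / c) *s (c *s v)" for k using assms by simp
    then show "vec.span {v} \<subseteq> vec.span {c *s v}"
      unfolding vec.span_singleton by blast
  qed
  with assms show ?thesis by (simp add: point_lift_def)
qed

lemma distinct_null_points_not_orthogonal:
  assumes h: "hermitian_form_21 h"
    and v: "point_lift v p" "h v v = 0" and w: "point_lift w q" "h w w = 0" and "p \<noteq> q"
  shows "h v w \<noteq> 0"
proof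
  assume "h v w = 0"
  then obtain a b where ab: "(a, b) \<noteq> (0, 0)" "a *s v = b *s w"
    using isotropic_orthogonal_imp_parallel[OF h v(2) w(2)] by metis
  have "v \<noteq> 0" "w \<noteq> 0" using v w by (auto simp: point_lift_def)
  with ab have "a \<noteq> 0" "b \<noteq> 0" by auto
  with ab v w have "point_lift (a *s v) p" "point_lift (a *s v) q"
    using point_lift_scale[of v p a] point_lift_scale[of w q b] by simp_all
  then show False using \<open>p \<noteq> q\<close> by (simp add: point_lift_def)
qed

section \<open>Unitary matrices\<close>

lemma cmod_eq_1_of_mult_cnj:
  assumes "z * cnj z = 1"
  shows "cmod z = 1"
proof -
  have "(cmod z)\<^sup>2 = 1\<^sup>2"
    using assms complex_mod_mult_cnj[of z] by simp
  then show ?thesis by (rule power2_eq_imp_eq) simp_all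
qed

lemma cmod_eq_1_of_cube:
  assumes "cmod (z ^ 3) = 1"
  shows "cmod z = 1"
proof -
  have "cmod z ^ 3 = 1 ^ 3" using assms by (simp add: norm_power)
  then show ?thesis by (rule power_eq_imp_eq_base) simp_all
qed

lemma det_zero_imp_kernel:
  fixes M :: "complex^3^3"
  assumes "det M = 0"
  obtains v where "v \<noteq> 0" "M *v v = 0"
proof -
  have "\<nexists>N. N ** M = mat 1"
    using assms invertible_det_nz[of M] invertible_left_inverse[of M] by simp
  then show ?thesis
    using that unfolding matrix_left_invertible_ker by blast
qed

lemma kernel_imp_det_zero:
  fixes M :: "complex^3^3"
  assumes "v \<noteq> 0" "M *v v = 0"
  shows "det M = 0"
proof (rule ccontr)
  assume "det M \<noteq> 0"
  then obtain N where "N ** M = mat 1"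
    using invertible_det_nz[of M] unfolding invertible_def by blast
  then have "v = N *v (M *v v)" by (simp add: matrix_vector_mul_assoc)
  with assms show False by simp
qed

text \<open>An isometry of the form is inverse to its own adjoint, so its spectrum is symmetric under
  \<open>z \<mapsto> 1 / cnj z\<close>: with this value of the parameter, the image of \<open>M - mat (1 / cnj z)\<close> is
  orthogonal to \<open>v\<close>, so that the matrix is singular.\<close>

lemma unitary_adjoint_eigenvalue:
  assumes h: "hermitian_form_21 h" and M: "M \<in> carrier (U21 h)"
    and v: "v \<noteq> 0" "M *v v = z *s v"
  obtains w where "w \<noteq> 0" "M *v w = inverse (cnj z) *s w"
proof -
  let ?\<mu> = "inverse (cnj z)"
  have iso: "h (M *v x) (M *v y) = h x y" for x y using M by (simp add: U21_def)
  have z: "z \<noteq> 0"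
  proof
    assume "z = 0"
    then have "h v y = 0" for y using iso[of v y] v by (simp add: form_zero[OF h])
    then show False using form_nondegenerate[OF h] v by blast
  qed
  have ort: "h ((M - mat ?\<mu>) *v x) v = 0" for x
  proof -
    have "cnj z * h (M *v x) v = h x v"
      using iso[of x v] v by (simp add: form_simps[OF h])
    then show ?thesis using z
      by (simp add: matrix_vector_mult_diff_rdistrib mat_vector_mult form_simps[OF h]
          form_diff[OF h] field_simps)
  qed
  have "det (M - mat ?\<mu>) = 0"
  proof (rule ccontr)
    assume "det (M - mat ?\<mu>) \<noteq> 0"
    then obtain N where "(M - mat ?\<mu>) ** N = mat 1"
      using invertible_det_nz[of "M - mat ?\<mu>"] unfolding invertible_def by blast
    then have "(M - mat ?\<mu>) *v (N *v y) = y" for y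
      by (simp add: matrix_vector_mul_assoc)
    then have "h y v = 0" for y using ort[of "N *v y"] by simp
    then have "h v y = 0" for y using form_cnj[OF h, of v y] by simp
    then show False using form_nondegenerate[OF h] v by blast
  qed
  then obtain w where "w \<noteq> 0" "(M - mat ?\<mu>) *v w = 0" by (rule det_zero_imp_kernel)
  then show ?thesis
    using that by (simp add: matrix_vector_mult_diff_rdistrib mat_vector_mult)
qed

lemma unitary_eigenvalue_not_unit_imp_null:
  assumes h: "hermitian_form_21 h" and M: "M \<in> carrier (U21 h)"
    and v: "M *v v = z *s v" and z: "cmod z \<noteq> 1"
  shows "h v v = 0"
proof -
  have "h v v = h (M *v v) (M *v v)" using M by (simp add: U21_def)
  then have "h v v = z * cnj z * h v v" by (simp add: v form_simps[OF h] mult.commute[of "cnj z"])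
  moreover have "z * cnj z \<noteq> 1"
    using z cmod_eq_1_of_mult_cnj by blast
  ultimately show ?thesis by simp
qed

text \<open>The two null vectors span a nondegenerate plane, so that a normal vector \<open>n\<close> completes them to
  a basis. The matrix preserves the line of \<open>n\<close>, and its determinant is its eigenvalue there.\<close>

lemma unitary_fixing_hyperbolic_pair:
  assumes h: "hermitian_form_21 h" and M: "M \<in> carrier (U21 h)" and det: "det M = 1"
    and null: "h v v = 0" "h w w = 0" and vw: "h v w \<noteq> 0"
    and fix': "M *v v = v" "M *v w = w"
  shows "M = mat 1"
proof -
  have iso: "h (M *v x) (M *v y) = h x y" for x y using M by (simp add: U21_def)
  have wv: "h w v \<noteq> 0" using vw form_cnj[OF h, of w v] by simp
  \<comment> \<open>A normal vector is a kernel vector of the two pairings. Padding them with a third, zero,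
    pairing gives an endomorphism, for which failing to be surjective means having a kernel.\<close>
  define f :: "complex^3 \<Rightarrow> complex^3" where
    "f x = (\<chi> i. h x (if i = 1 then v else if i = 2 then w else 0))" for x
  have lin: "Vector_Spaces.linear (*s) (*s) f"
    unfolding f_def by (rule linear_pairings[OF h])
  have "f x \<noteq> axis 3 1" for x
    by (auto simp: f_def vec_eq_iff axis_def form_zero[OF h] intro!: exI[of _ "3::3"])
  then have "\<not> surj f" by (metis surj_def)
  then have "\<not> inj f" using vec.linear_injective_imp_surjective[OF lin] by blast
  then obtain n where n: "n \<noteq> 0" "f n = 0"
    using vec.linear_inj_iff_eq_0[OF lin] by blast
  then have nv: "h n v = 0" and nw: "h n w = 0"
    by (auto simp: f_def vec_eq_iff forall_3)
  define P :: "complex^3^3" where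
    "P = (\<chi> i j. (if j = 1 then v else if j = 2 then w else n) $ i)"
  have P: "P *v c = c$1 *s v + c$2 *s w + c$3 *s n" for c
    by (simp add: P_def vec_eq_iff matrix_vector_mult_def sum_3 forall_3 mult.commute)
  have pair: "h (P *v c) v = c$2 * h w v" "h (P *v c) w = c$1 * h v w" for c
    by (simp_all add: P form_simps[OF h] null nv nw)
  have "c = 0" if "P *v c = 0" for c
  proof -
    have "c$1 = 0" "c$2 = 0"
      using pair[of c] that vw wv by (auto simp: form_zero[OF h])
    moreover from this have "c$3 = 0" using that n by (simp add: P)
    ultimately show ?thesis by (simp add: vec_eq_iff forall_3)
  qed
  then have inv: "invertible P"
    by (simp add: invertible_left_inverse matrix_left_invertible_ker)
  then obtain P' where P': "P ** P' = mat 1" unfolding invertible_def by blast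
  define c where "c = P' *v (M *v n)"
  have Mn: "M *v n = P *v c"
    using P' by (simp add: c_def matrix_vector_mul_assoc matrix_mul_assoc)
  have "h (M *v n) v = 0" "h (M *v n) w = 0"
    using iso[of n v] iso[of n w] fix' nv nw by simp_all
  then have "c$2 = 0" "c$1 = 0"
    using pair[of c] vw wv by (auto simp: Mn)
  then have Mn: "M *v n = c$3 *s n" by (simp add: Mn P)
  define D :: "complex^3^3" where
    "D = (\<chi> i j. if i = j then (if j = 3 then c$3 else 1) else 0)"
  have "(M ** P) *v x = (P ** D) *v x" for x
    by (simp add: P matrix_vector_right_distrib vec.scale fix' Mn flip: matrix_vector_mul_assoc)
       (simp add: D_def matrix_vector_mult_def sum_3 mult.commute)
  then have MP: "M ** P = P ** D" by (simp add: matrix_eq)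
  then have "det M * det P = det P * det D" by (metis det_mul)
  moreover have "det D = c$3" by (simp add: D_def det_3)
  moreover have "det P \<noteq> 0" using inv invertible_det_nz by blast
  ultimately have "c$3 = 1" using det by simp
  then have "D = mat 1" by (simp add: D_def mat_def vec_eq_iff)
  then have "M ** (P ** P') = P ** P'" using MP by (simp add: matrix_mul_assoc)
  then show ?thesis by (simp add: P')
qed

lemma unitary_determined_by_hyperbolic_pair:
  assumes h: "hermitian_form_21 h" and M: "M \<in> carrier (U21 h)" and N: "N \<in> carrier (U21 h)"
    and det: "det M = det N"
    and null: "h v v = 0" "h w w = 0" and vw: "h v w \<noteq> 0"
    and eq: "M *v v = N *v v" "M *v w = N *v w"
  shows "M = N"
proof -
  interpret group "U21 h" by (rule group_U21[OF h])
  have mult: "X \<otimes>\<^bsub>U21 h\<^esub> Y = X ** Y" and one: "\<one>\<^bsub>U21 h\<^esub> = mat 1" for X Y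
    by (simp_all add: U21_def)
  define K where "K = inv\<^bsub>U21 h\<^esub> N"
  have K: "K \<in> carrier (U21 h)" using N by (simp add: K_def)
  have KN: "K ** N = mat 1" and NK: "N ** K = mat 1"
    using l_inv[OF N] r_inv[OF N] by (simp_all only: K_def mult one)
  have KM: "K ** M \<in> carrier (U21 h)" using K M m_closed[of K M] by (simp only: mult)
  have "K ** M = mat 1"
  proof (rule unitary_fixing_hyperbolic_pair[OF h KM _ null vw])
    show "det (K ** M) = 1" using KN det by (metis det_mul det_I)
    show "(K ** M) *v v = v" "(K ** M) *v w = w"
      using KN by (simp_all add: eq matrix_vector_mul_assoc flip: matrix_vector_mul_assoc[of K M])
  qed
  then have "N ** (K ** M) = N" by simp
  then show ?thesis by (simp add: NK matrix_mul_assoc)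
qed

text \<open>Isometries with the same value on \<open>v\<close> that send \<open>w\<close> into the same line send it to the same
  vector: the pairing with the common image of \<open>v\<close> detects the factor.\<close>

lemma unitary_determined_by_null_points:
  assumes h: "hermitian_form_21 h" and M: "M \<in> carrier (U21 h)" and N: "N \<in> carrier (U21 h)"
    and det: "det M = det N"
    and null: "h v v = 0" "h w w = 0" and vw: "h v w \<noteq> 0"
    and v: "M *v v = N *v v" and w: "M *v w = c *s x" "N *v w = d *s x"
  shows "M = N"
proof (rule unitary_determined_by_hyperbolic_pair[OF h M N det null vw v])
  have "h (M *v v) (M *v w) = h v w" "h (N *v v) (N *v w) = h v w"
    using M N by (simp_all add: U21_def)
  then have 1: "cnj c * h (N *v v) x = h v w" "cnj d * h (N *v v) x = h v w"
    unfolding v w form_simps(4)[OF h] .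
  then have "h (N *v v) x \<noteq> 0" using vw by auto
  moreover have "cnj c * h (N *v v) x = cnj d * h (N *v v) x" using 1 by simp
  ultimately have "c = d" by simp
  with w show "M *v w = N *v w" by simp
qed

text \<open>Each eigenvalue \<open>x\<close> satisfies \<open>x ^ 3 = z\<close> as well as the characteristic equation. Subtracting
  leaves an equation of degree at most two with constant term \<open>det M - z\<close>; it has three distinct
  roots and hence is trivial.\<close>

lemma det_cube_root_of_scalar:
  fixes M :: "complex^3^3"
  assumes M3: "M ** M ** M = mat z" and card: "card (eigenvalues M) = 3"
  shows "det M = z"
proof -
  obtain a b c where abc: "eigenvalues M = {a, b, c}" "a \<noteq> b" "a \<noteq> c" "b \<noteq> c"
    using card by (auto simp: card_3_iff)
  \<comment> \<open>The other two coefficients of the characteristic polynomial: the trace and the sum of the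
    principal 2-by-2 minors.\<close>
  define t e where "t = M$1$1 + M$2$2 + M$3$3"
    and "e = M$1$1*M$2$2 - M$1$2*M$2$1 + M$1$1*M$3$3 - M$1$3*M$3$1 + M$2$2*M$3$3 - M$2$3*M$3$2"
  have charpoly: "det (M - mat x) = - (x^3) + t * x\<^sup>2 - e * x + det M" for x
    by (simp add: det_3 mat_def t_def e_def algebra_simps power2_eq_square power3_eq_cube)
  have root: "t * x\<^sup>2 - e * x + (det M - z) = 0" if "x \<in> {a, b, c}" for x
  proof -
    from that abc obtain v where v: "v \<noteq> 0" "M *v v = x *s v"
      by (auto simp: eigenvalues_def)
    then have "det (M - mat x) = 0"
      by (intro kernel_imp_det_zero[of v])
         (simp_all add: matrix_vector_mult_diff_rdistrib mat_vector_mult)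
    moreover have "x^3 = z"
    proof -
      have "(M ** M ** M) *v v = x^3 *s v"
        using v by (simp add: vec.scale power3_eq_cube flip: matrix_vector_mul_assoc)
      then have "z *s v = x^3 *s v" using M3 by (simp add: mat_vector_mult)
      then show ?thesis using v by simp
    qed
    ultimately show ?thesis using charpoly[of x] by (simp add: algebra_simps)
  qed
  have r: "t * a\<^sup>2 - e * a + (det M - z) = 0" "t * b\<^sup>2 - e * b + (det M - z) = 0"
    "t * c\<^sup>2 - e * c + (det M - z) = 0" using root by simp_all
  have "(x - y) * (t * (x + y) - e)
      = (t * x\<^sup>2 - e * x + (det M - z)) - (t * y\<^sup>2 - e * y + (det M - z))" for x y
    by (simp add: algebra_simps power2_eq_square)
  from this[of a b] this[of a c]
  have "(a - b) * (t * (a + b) - e) = 0" "(a - c) * (t * (a + c) - e) = 0"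
    unfolding r by simp_all
  then have 1: "t * (a + b) = e" "t * (a + c) = e" using abc(2,3) by simp_all
  then have "t * (a + b) - t * (a + c) = 0" by simp
  then have "t * (b - c) = 0" by (simp add: algebra_simps)
  then have "t = 0" using abc(4) by simp
  with 1(1) r(1) show ?thesis by simp
qed

section \<open>Projective isometries and their lifts\<close>

lemma PU21_coset:
  assumes h: "hermitian_form_21 h" and g: "g \<in> carrier (PU21 h)" and M: "M \<in> g"
  shows "M \<in> carrier (U21 h)" "g = unit_scalars #>\<^bsub>U21 h\<^esub> M"
proof -
  interpret normal unit_scalars "U21 h" by (rule normal_unit_scalars[OF h])
  from g obtain N where N: "N \<in> carrier (U21 h)" "g = unit_scalars #>\<^bsub>U21 h\<^esub> N"
    by (auto simp: PU21_def FactGroup_def RCOSETS_def)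
  with M show "g = unit_scalars #>\<^bsub>U21 h\<^esub> M"
    using repr_independence[OF _ _ is_subgroup] by blast
  show "M \<in> carrier (U21 h)"
    using N M r_coset_subset_G[OF subset] by blast
qed

lemma PU21_isometry:
  assumes "hermitian_form_21 h" "g \<in> carrier (PU21 h)" "M \<in> g"
  shows "h (M *v v) (M *v w) = h v w"
  using PU21_coset(1)[OF assms] by (simp add: U21_def)

lemma PU21_nonempty:
  assumes h: "hermitian_form_21 h" and g: "g \<in> carrier (PU21 h)"
  obtains M where "M \<in> g"
proof -
  interpret normal unit_scalars "U21 h" by (rule normal_unit_scalars[OF h])
  from g obtain M where "M \<in> carrier (U21 h)" "g = unit_scalars #>\<^bsub>U21 h\<^esub> M"
    by (auto simp: PU21_def FactGroup_def RCOSETS_def)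
  then have "M \<in> g" using rcos_self[OF _ is_subgroup] by blast
  then show ?thesis by (rule that)
qed

lemma PU21_scale:
  assumes h: "hermitian_form_21 h" and g: "g \<in> carrier (PU21 h)" and M: "M \<in> g" and z: "cmod z = 1"
  shows "mat z ** M \<in> g"
  using PU21_coset(2)[OF h g M] z by (auto simp: r_coset_def unit_scalars_def U21_def)

lemma PU21_mult:
  assumes "M \<in> g" "N \<in> k"
  shows "M ** N \<in> g \<otimes>\<^bsub>PU21 h\<^esub> k"
  using assms by (auto simp: PU21_def FactGroup_def set_mult_def U21_def)

lemma PU21_eqI:
  assumes h: "hermitian_form_21 h" and "g \<in> carrier (PU21 h)" "k \<in> carrier (PU21 h)"
    and "M \<in> g" "M \<in> k"
  shows "g = k"
  using assms PU21_coset(2) by metis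

lemma order_three_lift_cube:
  assumes h: "hermitian_form_21 h" and g: "g \<in> carrier (PU21 h)" "group.ord (PU21 h) g = 3"
    and M: "M \<in> g"
  obtains z where "cmod z = 1" "M ** M ** M = mat z"
proof -
  interpret group "PU21 h" by (rule group_PU21[OF h])
  have "g [^]\<^bsub>PU21 h\<^esub> (3::nat) = \<one>\<^bsub>PU21 h\<^esub>" using pow_ord_eq_1[OF g(1)] g(2) by simp
  then have "g \<otimes>\<^bsub>PU21 h\<^esub> g \<otimes>\<^bsub>PU21 h\<^esub> g = \<one>\<^bsub>PU21 h\<^esub>" using g
    by (simp add: numeral_3_eq_3)
  moreover have "M ** M ** M \<in> g \<otimes>\<^bsub>PU21 h\<^esub> g \<otimes>\<^bsub>PU21 h\<^esub> g" by (intro PU21_mult M)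
  ultimately have "M ** M ** M \<in> unit_scalars" by (simp add: PU21_def FactGroup_def)
  then show ?thesis using that by (auto simp: unit_scalars_def)
qed

lemma det_scale_3: "det (mat z ** M) = z^3 * det (M :: complex^3^3)"
  by (simp add: det_mul) (simp add: det_3 mat_def power3_eq_cube)

lemma complex_cube_root:
  fixes z :: complex
  obtains w where "w ^ 3 = z"
proof (cases "z = 0")
  case False
  have "exp (Ln z / 3) ^ 3 = exp (3 * (Ln z / 3))"
    by (metis exp_of_nat_mult of_nat_numeral)
  then show ?thesis using that False by simp
qed (use that[of 0] in simp)

text \<open>A lift has a determinant of modulus 1 because its cube is a unit scalar; a cube root of the
  inverse determinant rescales it into \<open>SU(2,1)\<close>.\<close>

lemma order_three_SU_lift:
  assumes h: "hermitian_form_21 h" and g: "g \<in> carrier (PU21 h)" "group.ord (PU21 h) g = 3"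
  obtains M where "M \<in> SU_lifts g"
proof -
  obtain M where M: "M \<in> g" by (rule PU21_nonempty[OF h g(1)])
  obtain z where z: "cmod z = 1" "M ** M ** M = mat z"
    by (rule order_three_lift_cube[OF h g M])
  have "det M ^ 3 = z ^ 3"
    using det_scale_3[of z "mat 1"] arg_cong[OF z(2), of det] by (simp add: det_mul power3_eq_cube)
  then have d: "cmod (det M) = 1"
    by (intro cmod_eq_1_of_cube[of "det M"]) (simp add: norm_power z)
  obtain w where w: "w ^ 3 = inverse (det M)" by (rule complex_cube_root)
  then have "cmod (w^3) = 1" using d by (simp add: norm_inverse)
  then have "cmod w = 1" by (rule cmod_eq_1_of_cube)
  then have "mat w ** M \<in> g" by (rule PU21_scale[OF h g(1) M])
  moreover have "det M \<noteq> 0" using d by auto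
  then have "det (mat w ** M) = 1" by (simp add: det_scale_3 w)
  ultimately show ?thesis using that by (auto simp: SU_lifts_def)
qed

text \<open>Order three in \<open>PU(2,1)\<close> only says that the cube is a scalar. Three distinct
  eigenvalues force that scalar to be the determinant.\<close>

lemma regular_order_three_SU_lift_cube:
  assumes h: "hermitian_form_21 h" and g: "regular_elliptic h g" "group.ord (PU21 h) g = 3"
    and M: "M \<in> SU_lifts g"
  shows "M ** M ** M = mat 1"
proof -
  have gc: "g \<in> carrier (PU21 h)" and card: "card (eigenvalues M) = 3"
    using g M by (auto simp: regular_elliptic_def elliptic_def)
  have M': "M \<in> g" "det M = 1" using M by (auto simp: SU_lifts_def)
  obtain z where "M ** M ** M = mat z"
    by (rule order_three_lift_cube[OF h gc g(2) M'(1)])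
  then show ?thesis using det_cube_root_of_scalar[OF _ card] M' by metis
qed

lemma act_lift:
  assumes h: "hermitian_form_21 h" and g: "g \<in> carrier (PU21 h)" and M: "M \<in> g"
    and v: "point_lift v p"
  shows "point_lift (M *v v) (act g p)"
proof -
  have "M *v v \<noteq> 0"
  proof
    assume 0: "M *v v = 0"
    then have "h v w = 0" for w
      using PU21_isometry[OF h g M, of v w] by (simp add: 0 form_zero[OF h])
    then show False using form_nondegenerate[OF h] v by (auto simp: point_lift_def)
  qed
  then show ?thesis
    using act_line[OF h g M, of v] v by (simp add: point_lift_def)
qed

lemma parabolic_fixed_point:
  assumes "parabolic h g" "p \<in> fixed_points h g"
  shows "fixed_points h g = {p}" "p \<in> ideal_boundary h"
  using assms by (auto simp: parabolic_def)

lemma ideal_boundary_lift_null: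
  assumes h: "hermitian_form_21 h" and "p \<in> ideal_boundary h" "point_lift v p"
  shows "h v v = 0"
proof -
  obtain w where w: "h w w = 0" "point_lift w p"
    using assms by (auto simp: ideal_boundary_def point_lift_def)
  then obtain c where "v = c *s w" using point_lift_unique assms by metis
  then show ?thesis by (simp add: w form_simps[OF h])
qed

text \<open>If \<open>cmod z \<noteq> 1\<close>, the eigenvalue \<open>1 / cnj z\<close> is different from \<open>z\<close> and has an eigenvector that is
  again null: a second boundary fixed point, which a parabolic isometry does not have.\<close>

lemma parabolic_eigenvalue_unit:
  assumes h: "hermitian_form_21 h" and g: "parabolic h g" and M: "M \<in> g"
    and v: "point_lift v p" "p \<in> fixed_points h g" "M *v v = z *s v"
  shows "cmod z = 1"
proof (rule ccontr)
  assume z: "cmod z \<noteq> 1"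
  have gc: "g \<in> carrier (PU21 h)" using g by (simp add: parabolic_def)
  have MU: "M \<in> carrier (U21 h)" by (rule PU21_coset(1)[OF h gc M])
  have v0: "v \<noteq> 0" using v by (simp add: point_lift_def)
  obtain w where w: "w \<noteq> 0" "M *v w = inverse (cnj z) *s w"
    by (rule unitary_adjoint_eigenvalue[OF h MU v0 v(3)])
  have z': "cmod (inverse (cnj z)) \<noteq> 1" using z by (simp add: norm_inverse)
  have null: "h w w = 0" by (rule unitary_eigenvalue_not_unit_imp_null[OF h MU w(2) z'])
  have lift: "point_lift w (vec.span {w})" using w by (simp add: point_lift_def)
  have z0: "inverse (cnj z) \<noteq> 0"
    using act_lift[OF h gc M lift] w(2) by (auto simp: point_lift_def)
  have "act g (vec.span {w}) = vec.span {w}"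
    using act_lift[OF h gc M lift] point_lift_scale[OF lift z0] w(2)
    by (simp add: point_lift_def)
  then have "vec.span {w} \<in> fixed_points h g"
    using w null by (auto simp: fixed_points_def ideal_boundary_def)
  then have "vec.span {w} = p" using parabolic_fixed_point(1)[OF g v(2)] by simp
  with lift v obtain c where c: "w = c *s v" using point_lift_unique by metis
  then have "z *s w = inverse (cnj z) *s w"
    using w v by (simp add: vec.scale mult.commute)
  then have "z = inverse (cnj z)" using w by simp
  then have "z * cnj z = 1" using z0 by (metis inverse_nonzero_iff_nonzero left_inverse)
  then show False using z cmod_eq_1_of_mult_cnj by blast
qed

lemma act_mult:
  assumes h: "hermitian_form_21 h" and g: "g \<in> carrier (PU21 h)" and k: "k \<in> carrier (PU21 h)"
    and p: "p \<in> complex_hyperbolic_plane h \<union> ideal_boundary h"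
  shows "act (g \<otimes>\<^bsub>PU21 h\<^esub> k) p = act g (act k p)"
proof -
  interpret group "PU21 h" by (rule group_PU21[OF h])
  obtain v where v: "p = vec.span {v}"
    using p by (auto simp: complex_hyperbolic_plane_def ideal_boundary_def)
  obtain M N where MN: "M \<in> g" "N \<in> k"
    using PU21_nonempty[OF h g] PU21_nonempty[OF h k] by metis
  have "act (g \<otimes>\<^bsub>PU21 h\<^esub> k) p = vec.span {(M ** N) *v v}"
    unfolding v by (rule act_line[OF h m_closed[OF g k] PU21_mult[OF MN]])
  also have "\<dots> = act g (act k p)"
    by (simp add: v act_line[OF h g MN(1)] act_line[OF h k MN(2)] matrix_vector_mul_assoc)
  finally show ?thesis .
qed

lemma act_closed:
  assumes h: "hermitian_form_21 h" and g: "g \<in> carrier (PU21 h)"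
    and p: "p \<in> complex_hyperbolic_plane h \<union> ideal_boundary h"
  shows "act g p \<in> complex_hyperbolic_plane h \<union> ideal_boundary h"
proof -
  obtain M where M: "M \<in> g" by (rule PU21_nonempty[OF h g])
  note iso = PU21_isometry[OF h g M]
  from p consider v where "p = vec.span {v}" "Re (h v v) < 0"
    | v where "p = vec.span {v}" "v \<noteq> 0" "h v v = 0"
    by (auto simp: complex_hyperbolic_plane_def ideal_boundary_def)
  then show ?thesis
  proof cases
    case 1
    then have "act g p \<in> complex_hyperbolic_plane h"
      unfolding complex_hyperbolic_plane_def using act_line[OF h g M, of v] iso[of v v] by auto
    then show ?thesis by blast
  next
    case 2
    then have "point_lift (M *v v) (act g p)"
      by (intro act_lift[OF h g M]) (simp add: point_lift_def)
    then have "act g p \<in> ideal_boundary h"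
      unfolding ideal_boundary_def point_lift_def using 2 iso[of v v] by auto
    then show ?thesis by blast
  qed
qed

text \<open>The isometry \<open>g\<close> conjugates \<open>k g\<close> to \<open>g k\<close>.\<close>

lemma act_fixed_points_conj:
  assumes h: "hermitian_form_21 h" and g: "g \<in> carrier (PU21 h)" and k: "k \<in> carrier (PU21 h)"
    and p: "p \<in> fixed_points h (k \<otimes>\<^bsub>PU21 h\<^esub> g)"
  shows "act g p \<in> fixed_points h (g \<otimes>\<^bsub>PU21 h\<^esub> k)"
proof -
  have pt: "p \<in> complex_hyperbolic_plane h \<union> ideal_boundary h"
    and fix_p: "act k (act g p) = p"
    using p act_mult[OF h k g] by (auto simp: fixed_points_def)
  have "act g p \<in> complex_hyperbolic_plane h \<union> ideal_boundary h"
    by (rule act_closed[OF h g pt])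
  with fix_p show ?thesis
    using act_mult[OF h g k, of "act g p"] by (simp add: fixed_points_def)
qed

lemma eigenvalue_at_fixed_point:
  assumes h: "hermitian_form_21 h" and g: "g \<in> carrier (PU21 h)" and M: "M \<in> g"
    and v: "point_lift v p" "act g p = p"
  shows "M *v v = eigenvalue_at M p *s v"
proof -
  have "point_lift (M *v v) p" using act_lift[OF h g M v(1)] v(2) by simp
  then obtain c where c: "M *v v = c *s v" using point_lift_unique[OF v(1)] by metis
  with eigenvalue_at_eq[OF v(1) c] show ?thesis by simp
qed

section \<open>Two triangle rotations\<close>

text \<open>Moving every pairing to \<open>h v1 v2\<close> or its conjugate by the two rotations: \<open>h v3 v1 = h v1 v2\<close>
  and \<open>h v3 v2 = h v2 v1\<close> along the first triangle, and the same up to powers of \<open>s\<close> and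
  \<open>cnj s\<close> along the second.\<close>

lemma cross_ratio_of_two_triangles:
  assumes h: "hermitian_form_21 h" and M: "M \<in> carrier (U21 h)" "N \<in> carrier (U21 h)"
    and m: "M *v v2 = v1" "M *v v1 = v3" "M *v v3 = v2"
    and n: "N *v v1 = s *s v2" "N *v v2 = v4" "N *v v4 = inverse s *s v1"
    and s: "s \<noteq> 0" and nz: "h v1 v2 \<noteq> 0"
  shows "cross_ratio_vec h v1 v2 v3 v4 = s / (cnj s)\<^sup>2"
proof -
  note simps = form_simps[OF h]
  have isoM: "h (M *v x) (M *v y) = h x y" and isoN: "h (N *v x) (N *v y) = h x y" for x y
    using M by (simp_all add: U21_def)
  have nz': "h v2 v1 \<noteq> 0" using nz form_cnj[OF h, of v2 v1] by simp
  have 31: "h v3 v1 = h v1 v2" using isoM[of v1 v2] m by simp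
  have 32: "h v3 v2 = h v2 v1" using isoM[of v1 v3] isoM[of v2 v1] m by simp
  have 42: "h v4 v2 = h v2 v1 / cnj s" using isoN[of v2 v1] n s by (simp add: simps field_simps)
  have 24: "h v2 v4 = h v1 v2 / s" using isoN[of v1 v2] n s by (simp add: simps field_simps)
  have 41: "h v4 v1 = cnj s * h v1 v2 / s" using isoN[of v2 v4] n s 24 by (simp add: simps field_simps)
  show ?thesis
    unfolding cross_ratio_vec_def 31 32 42 41 using nz nz' s
    by (simp add: field_simps power2_eq_square)
qed

text \<open>The lift \<open>v2\<close> is a parameter so that the scalars \<open>s\<close> obtained from two different lifts \<open>N\<close> of
  \<open>J2\<close> can be compared. The three vectors of a triangle may be linearly dependent, so the cubes of
  the lifts cannot be read off from their action on them.\<close>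

lemma cross_ratio_of_two_triangle_rotations:
  assumes h: "hermitian_form_21 h"
    and J1: "regular_elliptic h J1" "group.ord (PU21 h) J1 = 3"
    and J2: "regular_elliptic h J2" "group.ord (PU21 h) J2 = 3"
    and act1: "act J1 pB = pA" "act J1 pA = pAB" "act J1 pAB = pB"
    and act2: "act J2 pA = pB" "act J2 pB = pBA" "act J2 pBA = pA"
    and pB: "pB \<in> ideal_boundary h" "pA \<noteq> pB"
    and M: "M \<in> SU_lifts J1" and N: "N \<in> SU_lifts J2"
    and v2: "point_lift v2 pB"
  obtains v1 v3 v4 s where
    "point_lift v1 pA" "point_lift v3 pAB" "point_lift v4 pBA"
    "h v1 v1 = 0" "h v2 v2 = 0" "h v3 v3 = 0" "h v4 v4 = 0"
    "M *v v2 = v1" "M *v v1 = v3" "M *v v3 = v2"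
    "N *v v1 = s *s v2" "N *v v2 = v4" "N *v v4 = inverse s *s v1" "s \<noteq> 0"
    "cross_ratio h pA pB pAB pBA = s / (cnj s)\<^sup>2"
proof -
  have c: "J1 \<in> carrier (PU21 h)" "J2 \<in> carrier (PU21 h)"
    using J1 J2 by (auto simp: regular_elliptic_def elliptic_def)
  have MN: "M \<in> J1" "N \<in> J2" using M N by (auto simp: SU_lifts_def)
  note U = PU21_coset(1)[OF h c(1) MN(1)] PU21_coset(1)[OF h c(2) MN(2)]
  note iso = PU21_isometry[OF h c(1) MN(1)] PU21_isometry[OF h c(2) MN(2)]
  have M3: "M *v (M *v (M *v v)) = v" and N3: "N *v (N *v (N *v v)) = v" for v
    using regular_order_three_SU_lift_cube[OF h J1 M] regular_order_three_SU_lift_cube[OF h J2 N]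
    by (simp_all add: matrix_vector_mul_assoc matrix_mul_assoc)
  define v1 v3 v4 where "v1 = M *v v2" and "v3 = M *v v1" and "v4 = N *v v2"
  have 1: "point_lift v1 pA"
    using act_lift[OF h c(1) MN(1) v2] by (simp add: v1_def act1)
  have 3: "point_lift v3 pAB"
    using act_lift[OF h c(1) MN(1) 1] by (simp add: v3_def act1)
  have 4: "point_lift v4 pBA"
    using act_lift[OF h c(2) MN(2) v2] by (simp add: v4_def act2)
  note lifts = 1 3 4
  have "point_lift (N *v v1) pB"
    using act_lift[OF h c(2) MN(2) lifts(1)] act2 by simp
  then obtain s where s: "s \<noteq> 0" "N *v v1 = s *s v2" by (rule point_lift_unique[OF v2])
  have "s *s (N *v v4) = v1"
    using N3[of v1] s by (simp add: v4_def vec.scale)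
  then have n4: "N *v v4 = inverse s *s v1" using s by auto
  have null2: "h v2 v2 = 0" by (rule ideal_boundary_lift_null[OF h pB(1) v2])
  then have null: "h v1 v1 = 0" "h v3 v3 = 0" "h v4 v4 = 0"
    by (simp_all add: v1_def v3_def v4_def iso)
  have nz: "h v1 v2 \<noteq> 0"
    by (rule distinct_null_points_not_orthogonal[OF h lifts(1) null(1) v2 null2 pB(2)])
  have m: "M *v v2 = v1" "M *v v1 = v3" "M *v v3 = v2" "N *v v2 = v4"
    by (simp_all add: v1_def v3_def v4_def M3)
  have "cross_ratio h pA pB pAB pBA = s / (cnj s)\<^sup>2"
    unfolding cross_ratio_eq[OF h lifts(1) v2 lifts(2,3)]
    by (rule cross_ratio_of_two_triangles[OF h U m(1-3) s(2) m(4) n4 s(1) nz])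
  then show ?thesis
    by (rule that[OF lifts null(1) null2 null(2,3) m(1-3) s(2) m(4) n4 s(1)])
qed

theorem theorem4p2:
  fixes h :: form
    and \<rho> :: "F2_gen word set \<Rightarrow> (complex^3^3) set"
    and A B J1 J2 :: "(complex^3^3) set"
    and pA pB pAB pBA :: "(complex^3) set"
  assumes "hermitian_form_21 h"
    and "\<rho> \<in> hom F2 (PU21 h)"
    and "A = \<rho> (F2_class GenA)" and "B = \<rho> (F2_class GenB)"
    and "parabolic h A" and "parabolic h B" and "parabolic h (\<rho> (inv\<^bsub>F2\<^esub> F2_class GenC))"
    and "pA \<in> fixed_points h A" and "pB \<in> fixed_points h B"
    and "pAB \<in> fixed_points h (A \<otimes>\<^bsub>PU21 h\<^esub> B)"
    and "pBA \<in> fixed_points h (B \<otimes>\<^bsub>PU21 h\<^esub> A)"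
    and "distinct [pA, pB, pAB, pBA]"
    and "regular_elliptic h J1" and "group.ord (PU21 h) J1 = 3"
    and "act J1 pB = pA" and "act J1 pA = pAB" and "act J1 pAB = pB"
    and "regular_elliptic h J2" and "group.ord (PU21 h) J2 = 3"
    and "act J2 pA = pB" and "act J2 pB = pBA" and "act J2 pBA = pA"
  shows "A = J1 \<otimes>\<^bsub>PU21 h\<^esub> J2 \<and> B = J2 \<otimes>\<^bsub>PU21 h\<^esub> J1 \<longleftrightarrow>
    (\<exists>MA \<in> SU_lifts A. \<exists>MB \<in> SU_lifts B.
       eigenvalue_at MA pA = eigenvalue_at MB pB \<and>
       eigenvalue_at MA pA ^ 3 = cross_ratio h pA pB pAB pBA)"
    (is "?dec \<longleftrightarrow> ?eig")
proof -
  note h = assms(1) and J1 = assms(13,14) and act1 = assms(15-17)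
    and J2 = assms(18,19) and act2 = assms(20-22)
  interpret group "PU21 h" by (rule group_PU21[OF h])
  have c: "A \<in> carrier (PU21 h)" "B \<in> carrier (PU21 h)"
    "J1 \<in> carrier (PU21 h)" "J2 \<in> carrier (PU21 h)"
    using assms(5,6) J1 J2 by (auto simp: parabolic_def regular_elliptic_def elliptic_def)
  have "\<rho> (inv\<^bsub>F2\<^esub> F2_class GenC) = A \<otimes>\<^bsub>PU21 h\<^esub> B"
    unfolding F2_inv_c assms(3,4) by (rule hom_mult[OF assms(2) F2_class_carrier F2_class_carrier])
  then have AB: "parabolic h (A \<otimes>\<^bsub>PU21 h\<^esub> B)" using assms(7) by simp
  note bd = parabolic_fixed_point(2)[OF assms(6,9)]
  have ne: "pA \<noteq> pB" "pA \<noteq> pBA" "pB \<noteq> pAB" using assms(12) by auto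
  note triangles = cross_ratio_of_two_triangle_rotations[OF h J1 J2 act1 act2 bd ne(1)]
  obtain v2 where v2: "point_lift v2 pB"
    using bd by (auto simp: ideal_boundary_def point_lift_def)
  obtain M N where M: "M \<in> SU_lifts J1" and N: "N \<in> SU_lifts J2"
    using order_three_SU_lift[OF h c(3) J1(2)] order_three_SU_lift[OF h c(4) J2(2)] by metis
  have fix_pts: "act A pA = pA" "act B pB = pB"
    using assms(8,9) by (simp_all add: fixed_points_def)
  have MN: "M \<in> J1" "N \<in> J2" "det M = 1" "det N = 1"
    using M N by (auto simp: SU_lifts_def)
  have unit_power: "s / (cnj s)\<^sup>2 = s ^ 3" if "cmod s = 1" for s
  proof -
    have 1: "s * cnj s = 1" using that complex_norm_square[of s] by simp
    have "s ^ 3 * (cnj s)\<^sup>2 = s * (s * cnj s)\<^sup>2"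
      by (simp add: power2_eq_square power3_eq_cube ac_simps)
    then have "s ^ 3 * (cnj s)\<^sup>2 = s" by (simp add: 1)
    moreover have "cnj s \<noteq> 0" using that by auto
    ultimately show ?thesis by (simp add: field_simps)
  qed
  show ?thesis
  proof
    assume ?dec
    obtain v1 v3 v4 s where v: "point_lift v1 pA" "M *v v2 = v1" "N *v v1 = s *s v2"
      and cr: "cross_ratio h pA pB pAB pBA = s / (cnj s)\<^sup>2"
      by (rule triangles[OF M N v2])
    have lifts: "M ** N \<in> A" "N ** M \<in> B"
      using \<open>?dec\<close> PU21_mult[OF MN(1,2)] PU21_mult[OF MN(2,1)] by simp_all
    have eig: "(M ** N) *v v1 = s *s v1" "(N ** M) *v v2 = s *s v2"
      using v by (simp_all add: vec.scale flip: matrix_vector_mul_assoc)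
    have "cmod s = 1"
      by (rule parabolic_eigenvalue_unit[OF h assms(5) lifts(1) v(1) assms(8) eig(1)])
    then have "cross_ratio h pA pB pAB pBA = s ^ 3" using cr unit_power by simp
    moreover have "eigenvalue_at (M ** N) pA = s" "eigenvalue_at (N ** M) pB = s"
      using eigenvalue_at_eq[OF v(1) eig(1)] eigenvalue_at_eq[OF v2 eig(2)] .
    moreover have "M ** N \<in> SU_lifts A" "N ** M \<in> SU_lifts B"
      using lifts MN by (simp_all add: SU_lifts_def det_mul)
    ultimately show ?eig by metis
  next
    assume ?eig
    then obtain MA MB l where MA: "MA \<in> A" "det MA = 1" and MB: "MB \<in> B" "det MB = 1"
      and l: "eigenvalue_at MA pA = l" "eigenvalue_at MB pB = l"
      and cr: "cross_ratio h pA pB pAB pBA = l ^ 3"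
      by (auto simp: SU_lifts_def)
    obtain w1 s where w1: "point_lift w1 pA" "M *v v2 = w1" "N *v w1 = s *s v2" "s \<noteq> 0"
      and cr': "cross_ratio h pA pB pAB pBA = s / (cnj s)\<^sup>2"
      by (rule triangles[OF M N v2])
    have "cmod l = 1"
      by (rule parabolic_eigenvalue_unit[OF h assms(5) MA(1) w1(1) assms(8)])
         (use eigenvalue_at_fixed_point[OF h c(1) MA(1) w1(1) fix_pts(1)] l in simp)
    have "cmod s = 1"
    proof -
      have "cmod (s / (cnj s)\<^sup>2) = 1"
        using cr cr' \<open>cmod l = 1\<close> by (simp add: norm_power)
      then have "cmod s = (cmod s)\<^sup>2" using w1(4)
        by (simp add: norm_divide norm_power field_simps)
      then show ?thesis using w1(4) by (simp add: power2_eq_square)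
    qed
    then have "s ^ 3 = l ^ 3" using cr cr' unit_power by simp
    have l0: "l \<noteq> 0" using \<open>cmod l = 1\<close> by auto
    \<comment> \<open>A cube root of unity: it adjusts the lift of \<open>J2\<close> so that its scalar becomes \<open>l\<close>.\<close>
    define \<zeta> where "\<zeta> = l / s"
    define N' where "N' = mat \<zeta> ** N"
    have "N' \<in> J2" unfolding N'_def
      using PU21_scale[OF h c(4) MN(2)] \<open>cmod l = 1\<close> \<open>cmod s = 1\<close>
      by (simp add: \<zeta>_def norm_divide)
    moreover have "det N' = 1"
      using MN w1(4) l0 \<open>s ^ 3 = l ^ 3\<close> by (simp add: N'_def det_scale_3 \<zeta>_def power_divide)
    ultimately have N': "N' \<in> J2" "det N' = 1" "N' \<in> SU_lifts J2"
      by (simp_all add: SU_lifts_def)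
    obtain v1 v3 v4 s' where
      lifts: "point_lift v1 pA" "point_lift v3 pAB" "point_lift v4 pBA"
      and null: "h v1 v1 = 0" "h v2 v2 = 0" "h v3 v3 = 0" "h v4 v4 = 0"
      and m: "M *v v2 = v1" "M *v v1 = v3" "M *v v3 = v2"
      and n: "N' *v v1 = s' *s v2" "N' *v v2 = v4" "N' *v v4 = inverse s' *s v1"
      by (rule triangles[OF M N'(3) v2])
    have "N' *v v1 = l *s v2"
      using w1 m(1) by (simp add: N'_def \<zeta>_def mat_vector_mult flip: matrix_vector_mul_assoc)
    then have "s' = l" using n(1) v2 by (simp add: point_lift_def)
    have "act A pBA \<in> fixed_points h (A \<otimes>\<^bsub>PU21 h\<^esub> B)"
      by (rule act_fixed_points_conj[OF h c(1,2) assms(11)])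
    then have actA: "act A pBA = pAB"
      using parabolic_fixed_point(1)[OF AB assms(10)] by simp
    have actB: "act B pAB = pBA"
      using assms(11) act_mult[OF h c(2,1), of pBA] actA by (simp add: fixed_points_def)
    obtain a where a: "MA *v v4 = a *s v3"
      using point_lift_unique[OF lifts(2)] act_lift[OF h c(1) MA(1) lifts(3)] actA by metis
    obtain b where b: "MB *v v3 = b *s v4"
      using point_lift_unique[OF lifts(3)] act_lift[OF h c(2) MB(1) lifts(2)] actB by metis
    have prods: "M ** N' \<in> J1 \<otimes>\<^bsub>PU21 h\<^esub> J2" "N' ** M \<in> J2 \<otimes>\<^bsub>PU21 h\<^esub> J1"
      by (intro PU21_mult MN N')+
    have "MA = M ** N'"
    proof (rule unitary_determined_by_null_points[OF h, where v = v1 and w = v4 and x = v3])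
      show "MA \<in> carrier (U21 h)" by (rule PU21_coset(1)[OF h c(1) MA(1)])
      show "M ** N' \<in> carrier (U21 h)"
        by (rule PU21_coset(1)[OF h m_closed[OF c(3,4)] prods(1)])
      show "det MA = det (M ** N')" using MA MN N' by (simp add: det_mul)
      show "h v1 v1 = 0" "h v4 v4 = 0" by fact+
      show "h v1 v4 \<noteq> 0"
        by (rule distinct_null_points_not_orthogonal[OF h lifts(1) null(1) lifts(3) null(4) ne(2)])
      show "MA *v v1 = (M ** N') *v v1"
        using eigenvalue_at_fixed_point[OF h c(1) MA(1) lifts(1) fix_pts(1)] l(1) n(1) m(1) \<open>s' = l\<close>
        by (simp add: vec.scale flip: matrix_vector_mul_assoc)
      show "MA *v v4 = a *s v3" by (rule a)
      show "(M ** N') *v v4 = inverse s' *s v3"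
        using n(3) m(2) by (simp add: vec.scale flip: matrix_vector_mul_assoc)
    qed
    moreover have "MB = N' ** M"
    proof (rule unitary_determined_by_null_points[OF h, where v = v2 and w = v3 and x = v4])
      show "MB \<in> carrier (U21 h)" by (rule PU21_coset(1)[OF h c(2) MB(1)])
      show "N' ** M \<in> carrier (U21 h)"
        by (rule PU21_coset(1)[OF h m_closed[OF c(4,3)] prods(2)])
      show "det MB = det (N' ** M)" using MB MN N' by (simp add: det_mul)
      show "h v2 v2 = 0" "h v3 v3 = 0" by fact+
      show "h v2 v3 \<noteq> 0"
        by (rule distinct_null_points_not_orthogonal[OF h v2 null(2) lifts(2) null(3) ne(3)])
      show "MB *v v2 = (N' ** M) *v v2"
        using eigenvalue_at_fixed_point[OF h c(2) MB(1) v2 fix_pts(2)] l(2) n(1) m(1) \<open>s' = l\<close>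
        by (simp flip: matrix_vector_mul_assoc)
      show "MB *v v3 = b *s v4" by (rule b)
      show "(N' ** M) *v v3 = 1 *s v4"
        using n(2) m(3) by (simp flip: matrix_vector_mul_assoc)
    qed
    ultimately show ?dec
      using PU21_eqI[OF h c(1) m_closed[OF c(3,4)] MA(1)]
        PU21_eqI[OF h c(2) m_closed[OF c(4,3)] MB(1)] prods by simp
  qed
qed

end
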